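(* Let $j\in\mathbb{Z}$, $f\in E$, $x\geq 0$ and $\delta>0$. If $f(t)=0$ for all $t\in(x-\delta,x+\delta)\cap[0,\infty)$, then there is a positive constant $c$ such that $\left(S_{n,j}f\right)(x)=O\left(e^{-cn}\right)$ as $n\rightarrow\infty$.
   Context: For $A\ge 0$, $E_A$ denotes the space of locally integrable functions $f:[0,\infty)\to\mathbb{R}$ satisfying $|f(t)|\le Ke^{At}$ for all $t\ge 0$, for some constant $K>0$; and $E:=\bigcup_{A\ge 0}E_A$. Put $s_{n,k}(x)=\frac{(nx)^k}{k!}e^{-nx}$ for integers $k\ge 0$ and $s_{n,k}(x)=0$ for $k<0$ (with $0^0=1$). For $j\in\mathbb{Z}$, $f\in E_A$ and positive integers $n>A$, the operator $S_{n,j}$ is defined for $x\ge0$ by $$(S_{n,j}f)(x)=f(0)\sum_{k=0}^{j-1}s_{n,k}(x)+\sum_{k=j}^{\infty}s_{n,k}(x)\,n\int_0^\infty s_{n,k-j}(t)f(t)\,dt.$$ A sum is zero if its upper limit is smaller than its lower limit. *)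

theory Defs
  imports "HOL-Analysis.Analysis" "HOL-Library.Landau_Symbols"
begin

text \<open>
  Functions on \<open>[0,\<infinity>)\<close> are represented by total functions on the reals;
  their values at negative arguments are never used.
\<close>

definition locally_integrable :: "(real \<Rightarrow> real) \<Rightarrow> bool" where
  "locally_integrable f \<longleftrightarrow> (\<forall>C. compact C \<and> C \<subseteq> {0..} \<longrightarrow> set_integrable lebesgue C f)"

definition E_space :: "real \<Rightarrow> (real \<Rightarrow> real) set" where
  "E_space A = {f. locally_integrable f \<and> (\<exists>K>0. \<forall>t\<ge>0. \<bar>f t\<bar> \<le> K * exp (A * t))}"

definition E_union :: "(real \<Rightarrow> real) set" where
  "E_union = (\<Union>A\<in>{0..}. E_space A)"

definition s_basis :: "nat \<Rightarrow> int \<Rightarrow> real \<Rightarrow> real" where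
  "s_basis n k x =
     (if k < 0 then 0 else (real n * x) ^ nat k / fact (nat k) * exp (- (real n * x)))"

text \<open>
  The series over the integers \<open>k = j, j + 1, \<dots>\<close> is written as an ordinary series
  over \<open>i = 0, 1, \<dots>\<close> with \<open>k = j + i\<close>. For \<open>f \<in> E_space A\<close> the operator is meaningful
  for \<open>n > A\<close>, where the integrals and the series converge; for the remaining
  finitely many \<open>n\<close> the value is arbitrary.
\<close>

definition S_op :: "nat \<Rightarrow> int \<Rightarrow> (real \<Rightarrow> real) \<Rightarrow> real \<Rightarrow> real" where
  "S_op n j f x =
     f 0 * (\<Sum>k = 0..j - 1. s_basis n k x) +
     (\<Sum>i. let k = j + int i in
        s_basis n k x * (real n * (LINT t:{0..}|lebesgue. s_basis n (k - j) t * f t)))"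

end

theory Submission
  imports Defs
begin

text \<open>
  The number \<open>s_basis n k y\<close> is the probability that a Poisson variable with mean \<open>n * y\<close> takes
  the value \<open>k\<close>. In the series that defines the operator, the weights at \<open>x\<close> and at \<open>t\<close> are
  multiplied at indices that differ by the constant \<open>j\<close>. Two such Poisson distributions with
  \<open>t \<noteq> x\<close> concentrate around means that are \<open>n * \<bar>t - x\<bar>\<close> apart, so the sum of the products
  should be exponentially small in \<open>n\<close>.

  Chernoff's method makes this precise. Changing the mean by a factor \<open>\<rho>\<close> costs the explicit factor
  of \<open>s_basis_tilt\<close>. The mean at \<open>x\<close> is multiplied by \<open>\<rho>\<close> and the mean at \<open>t\<close> is divided by
  \<open>\<rho>\<close>; the powers of \<open>\<rho>\<close> that depend on the summation index then cancel, and what remains of the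
  sum is at most \<open>1\<close>. This gives the bound \<open>\<rho> powi (- j) * exp (- n * (\<rho> - 1) * (t / \<rho> - x))\<close>
  of \<open>kernel_sum_tilt_bound\<close>. One fixed \<open>\<rho>\<close> slightly above \<open>1\<close> serves all \<open>t \<ge> x + \<delta>\<close>, and one
  slightly below \<open>1\<close> serves all \<open>t \<le> x - \<delta>\<close>. Because \<open>(\<rho> - 1) * (t / \<rho> - x)\<close> is affine in \<open>t\<close>,
  it even dominates a multiple of \<open>1 + t\<close> there (\<open>kernel_localization\<close>), and for large \<open>n\<close> this absorbs the
  growth \<open>exp (A * t)\<close> of \<open>f\<close> and leaves an integrable function (\<open>series_part_bound\<close>).

  The term with \<open>f 0\<close> vanishes if \<open>x < \<delta>\<close>. Otherwise \<open>x > 0\<close>, and a fixed number of Poisson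
  weights with mean \<open>n * x\<close> sum to an exponentially small number, again by tilting
  (\<open>initial_sum_exponentially_small\<close>).
\<close>

section \<open>Exponential tilting of the Poisson weights\<close>

lemma s_basis_nonneg: "0 \<le> y \<Longrightarrow> 0 \<le> s_basis n k y"
  by (simp add: s_basis_def)

lemma s_basis_sum_le_1:
  assumes "finite I" "0 \<le> y"
  shows "(\<Sum>k\<in>I. s_basis n k y) \<le> 1"
proof -
  define J where "J = {k\<in>I. 0 \<le> k}"
  let ?w = "\<lambda>m. (real n * y) ^ m / fact m"
  have sums: "?w sums exp (real n * y)"
    using exp_converges[of "real n * y"] by (simp add: divide_inverse mult.commute)
  have inj: "inj_on nat J"
    by (auto simp: inj_on_def J_def)
  have "(\<Sum>k\<in>I. s_basis n k y) = (\<Sum>k\<in>J. s_basis n k y)"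
    unfolding J_def by (intro sum.mono_neutral_right) (auto simp: assms s_basis_def)
  also have "\<dots> = (\<Sum>k\<in>J. ?w (nat k)) * exp (- (real n * y))"
    unfolding sum_distrib_right by (intro sum.cong) (auto simp: J_def s_basis_def)
  also have "(\<Sum>k\<in>J. ?w (nat k)) = sum ?w (nat ` J)"
    by (simp add: sum.reindex[OF inj])
  also have "\<dots> \<le> exp (real n * y)"
    using sums assms sum_le_suminf[of ?w "nat ` J"] by (auto simp: sums_iff J_def)
  finally show ?thesis
    by (simp add: exp_minus mult_right_mono field_simps)
qed

lemma s_basis_le_1: "0 \<le> y \<Longrightarrow> s_basis n k y \<le> 1"
  using s_basis_sum_le_1[of "{k}"] by simp

text \<open>
  The change of measure between Poisson distributions of different means. With
  \<open>\<rho> < 1\<close> it shows that weights far below the mean are small, with \<open>\<rho> > 1\<close> those far above.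
\<close>

lemma s_basis_tilt:
  assumes "\<rho> > 0"
  shows "s_basis n k y = \<rho> powi (- k) * exp (real n * (\<rho> - 1) * y) * s_basis n k (\<rho> * y)"
proof (cases "k < 0")
  case False
  then obtain m where k: "k = int m"
    by (metis nat_0_le not_less)
  have "exp (real n * (\<rho> - 1) * y) * exp (- (real n * (\<rho> * y))) = exp (- (real n * y))"
    by (simp add: exp_add[symmetric] algebra_simps)
  moreover have "\<rho> powi (- int m) * \<rho> ^ m = 1"
    using assms by (simp add: power_int_minus)
  ultimately have "s_basis n k y = (\<rho> powi (- int m) * \<rho> ^ m) * (real n * y) ^ m / fact m *
      (exp (real n * (\<rho> - 1) * y) * exp (- (real n * (\<rho> * y))))"
    unfolding k s_basis_def by simp
  also have "\<dots> = \<rho> powi (- k) * exp (real n * (\<rho> - 1) * y) * s_basis n k (\<rho> * y)"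
    unfolding k s_basis_def by (simp add: power_mult_distrib)
  finally show ?thesis .
qed (simp add: s_basis_def)

section \<open>Localisation of the kernel\<close>

text \<open>
  Partial sums suffice for all later purposes: being bounded uniformly in \<open>N\<close>, they can be
  integrated against a majorant of \<open>\<bar>f\<bar>\<close> before the limit is taken, so that sum and integral are interchanged
  only for finitely many terms.
\<close>

lemma kernel_sum_tilt_bound:
  assumes "\<rho> > 0" "0 \<le> x" "0 \<le> t"
  shows "(\<Sum>i<N. s_basis n (j + int i) x * s_basis n (int i) t)
           \<le> \<rho> powi (- j) * exp (- (real n * ((\<rho> - 1) * (t / \<rho> - x))))"
proof -
  let ?B = "\<rho> powi (- j) * exp (- (real n * ((\<rho> - 1) * (t / \<rho> - x))))"
  have term_eq: "s_basis n (j + int i) x * s_basis n (int i) t =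
      ?B * (s_basis n (j + int i) (\<rho> * x) * s_basis n (int i) (t / \<rho>))" for i
  proof -
    let ?u = "exp (real n * (\<rho> - 1) * x)" and ?v = "exp (real n * (1 / \<rho> - 1) * t)"
    have "s_basis n (int i) t = \<rho> powi int i * ?v * s_basis n (int i) (t / \<rho>)"
      using s_basis_tilt[of "1 / \<rho>" n "int i" t] assms
      by (simp add: power_int_minus power_one_over divide_inverse power_inverse mult.commute)
    then have "s_basis n (j + int i) x * s_basis n (int i) t =
        (\<rho> powi (- (j + int i)) * \<rho> powi int i) * (?u * ?v) *
        (s_basis n (j + int i) (\<rho> * x) * s_basis n (int i) (t / \<rho>))"
      using s_basis_tilt[OF assms(1), of n "j + int i" x] by (simp only: mult_ac)
    also have "\<rho> powi (- (j + int i)) * \<rho> powi int i = \<rho> powi (- j)"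
      using assms by (subst power_int_add[symmetric]) auto
    also have "?u * ?v = exp (- (real n * ((\<rho> - 1) * (t / \<rho> - x))))"
      using assms by (simp add: exp_add[symmetric] field_simps)
    finally show ?thesis .
  qed
  have "(\<Sum>i<N. s_basis n (j + int i) (\<rho> * x) * s_basis n (int i) (t / \<rho>))
      \<le> (\<Sum>i<N. s_basis n (j + int i) (\<rho> * x))"
    using assms by (intro sum_mono mult_left_le s_basis_le_1 s_basis_nonneg) auto
  also have "\<dots> = (\<Sum>k\<in>(\<lambda>i. j + int i) ` {..<N}. s_basis n k (\<rho> * x))"
    by (subst sum.reindex) (auto simp: inj_on_def)
  also have "\<dots> \<le> 1"
    using assms by (intro s_basis_sum_le_1) auto
  finally have "?B * (\<Sum>i<N. s_basis n (j + int i) (\<rho> * x) * s_basis n (int i) (t / \<rho>)) \<le> ?B * 1"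
    using assms by (intro mult_left_mono) auto
  then show ?thesis
    unfolding term_eq sum_distrib_left by simp
qed

text \<open>
  The decay rate \<open>(\<rho> - 1) * (t / \<rho> - x)\<close> is positive for \<open>\<rho> > 1\<close> as soon as \<open>t > \<rho> * x\<close>. The
  choice below keeps \<open>\<rho> * x\<close> at least \<open>\<delta> / 2\<close> to the left of \<open>x + \<delta>\<close>; the lower bound that
  grows with \<open>t\<close> is what makes the kernel integrable against an exponential.
\<close>

lemma tilt_right:
  fixes x \<delta> :: real
  assumes "0 \<le> x" "0 < \<delta>"
  shows "\<exists>\<rho>>0. \<exists>c>0. \<forall>t\<ge>x + \<delta>. c * (1 + t) \<le> (\<rho> - 1) * (t / \<rho> - x)"
proof -
  define \<rho> where "\<rho> = 1 + \<delta> / (2 * (x + 1))"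
  \<comment> \<open>The line through \<open>(- 1, 0)\<close> and \<open>(x + \<delta>, \<delta> / 2)\<close> has slope \<open>\<kappa>\<close>; as \<open>\<kappa> \<le> 1\<close>, it stays
    below \<open>t - \<rho> * x\<close> to the right of \<open>x + \<delta>\<close>.\<close>
  define \<kappa> where "\<kappa> = (\<delta> / 2) / (1 + x + \<delta>)"
  have \<rho>: "\<rho> > 1"
    using assms by (simp add: \<rho>_def)
  have "\<delta> * x \<le> \<delta> * (x + 1)"
    using assms by simp
  then have \<rho>x: "\<rho> * x \<le> x + \<delta> / 2"
    using assms by (simp add: \<rho>_def field_simps)
  have \<kappa>: "0 < \<kappa>" "\<kappa> \<le> 1"
    using assms by (simp_all add: \<kappa>_def)
  have \<kappa>_eq: "\<kappa> * (1 + x + \<delta>) = \<delta> / 2"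
    unfolding \<kappa>_def using assms by (intro nonzero_eq_divide_eq[THEN iffD1]) auto
  have "((\<rho> - 1) / \<rho> * \<kappa>) * (1 + t) \<le> (\<rho> - 1) * (t / \<rho> - x)" if "x + \<delta> \<le> t" for t
  proof -
    have "\<kappa> * (t - x - \<delta>) \<le> 1 * (t - x - \<delta>)"
      using that \<kappa> by (intro mult_right_mono) auto
    then have "\<kappa> * (1 + t) \<le> t - \<rho> * x"
      using \<kappa>_eq \<rho>x by (simp add: algebra_simps)
    then have "(\<rho> - 1) / \<rho> * (\<kappa> * (1 + t)) \<le> (\<rho> - 1) / \<rho> * (t - \<rho> * x)"
      using \<rho> by (intro mult_left_mono) auto
    also have "\<dots> = (\<rho> - 1) * (t / \<rho> - x)"
      using \<rho> by (simp add: field_simps)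
    finally show ?thesis
      by (simp add: mult.assoc)
  qed
  moreover have "(\<rho> - 1) / \<rho> * \<kappa> > 0"
    using \<rho> \<kappa> by simp
  ultimately show ?thesis
    using \<rho> by (intro exI[of _ \<rho>] conjI exI[of _ "(\<rho> - 1) / \<rho> * \<kappa>"]) auto
qed

text \<open>
  Symmetrically, the decay rate is positive for \<open>\<rho> < 1\<close> if \<open>t < \<rho> * x\<close>, and here \<open>\<rho> * x\<close> is the
  midpoint of \<open>x - \<delta>\<close> and \<open>x\<close>. Since \<open>t\<close> is bounded, the factor \<open>1 + t\<close> costs only a
  constant; it is there to match the estimate on the right.
\<close>

lemma tilt_left:
  fixes x \<delta> :: real
  assumes "0 < \<delta>"
  shows "\<exists>\<rho>>0. \<exists>c>0. \<forall>t. 0 \<le> t \<and> t \<le> x - \<delta> \<longrightarrow> c * (1 + t) \<le> (\<rho> - 1) * (t / \<rho> - x)"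
proof (cases "x < \<delta>")
  case True
  then show ?thesis
    by (intro exI[of _ 1] conjI) auto
next
  case False
  define \<rho> where "\<rho> = 1 - \<delta> / (2 * x)"
  define c where "c = (1 - \<rho>) / \<rho> * (\<delta> / 2) / (1 + x)"
  have x: "x > 0"
    using False assms by simp
  have \<rho>: "0 < \<rho>" "\<rho> < 1" "\<rho> * x = x - \<delta> / 2"
    using False assms x by (simp_all add: \<rho>_def field_simps)
  have c: "c > 0" "c * (1 + x) = (1 - \<rho>) / \<rho> * (\<delta> / 2)"
    using \<rho> x assms by (simp_all add: c_def)
  have "c * (1 + t) \<le> (\<rho> - 1) * (t / \<rho> - x)" if "0 \<le> t" "t \<le> x - \<delta>" for t
  proof -
    have "c * (1 + t) \<le> c * (1 + x)"
      using that assms c by (intro mult_left_mono) auto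
    also have "\<dots> \<le> (1 - \<rho>) / \<rho> * (\<rho> * x - t)"
      unfolding c(2) using \<rho> that by (intro mult_left_mono) auto
    also have "\<dots> = (\<rho> - 1) * (t / \<rho> - x)"
      using \<rho> by (simp add: field_simps)
    finally show ?thesis .
  qed
  then show ?thesis
    using \<rho> c by (intro exI[of _ \<rho>] conjI exI[of _ c]) auto
qed

lemma kernel_localization:
  fixes x \<delta> :: real
  assumes "0 \<le> x" "0 < \<delta>"
  shows "\<exists>C>0. \<exists>c>0. \<forall>n N t. 0 \<le> t \<and> \<delta> \<le> \<bar>t - x\<bar> \<longrightarrow>
    (\<Sum>i<N. s_basis n (j + int i) x * s_basis n (int i) t) \<le> C * exp (- (real n * (c * (1 + t))))"
proof -
  obtain \<rho>1 c1 where right: "\<rho>1 > 0" "c1 > 0"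
      "\<And>t. x + \<delta> \<le> t \<Longrightarrow> c1 * (1 + t) \<le> (\<rho>1 - 1) * (t / \<rho>1 - x)"
    using tilt_right[OF assms] by blast
  obtain \<rho>2 c2 where left: "\<rho>2 > 0" "c2 > 0"
      "\<And>t. 0 \<le> t \<Longrightarrow> t \<le> x - \<delta> \<Longrightarrow> c2 * (1 + t) \<le> (\<rho>2 - 1) * (t / \<rho>2 - x)"
    using tilt_left[OF assms(2)] by blast
  define C where "C = max (\<rho>1 powi (- j)) (\<rho>2 powi (- j))"
  define c where "c = min c1 c2"
  have bound: "(\<Sum>i<N. s_basis n (j + int i) x * s_basis n (int i) t)
      \<le> C * exp (- (real n * (c * (1 + t))))"
    if "\<rho> > 0" "\<rho> powi (- j) \<le> C" "c \<le> c'" "0 \<le> t" "c' * (1 + t) \<le> (\<rho> - 1) * (t / \<rho> - x)"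
    for \<rho> c' n N t
  proof -
    have "c * (1 + t) \<le> c' * (1 + t)"
      using that by (intro mult_right_mono) auto
    then have "c * (1 + t) \<le> (\<rho> - 1) * (t / \<rho> - x)"
      using that by linarith
    then have "real n * (c * (1 + t)) \<le> real n * ((\<rho> - 1) * (t / \<rho> - x))"
      by (intro mult_left_mono) auto
    then have "\<rho> powi (- j) * exp (- (real n * ((\<rho> - 1) * (t / \<rho> - x))))
        \<le> C * exp (- (real n * (c * (1 + t))))"
      using that by (intro mult_mono) (auto intro: order_trans[rotated])
    with kernel_sum_tilt_bound[OF that(1) assms(1) that(4)] show ?thesis
      by (rule order_trans)
  qed
  have "(\<Sum>i<N. s_basis n (j + int i) x * s_basis n (int i) t) \<le> C * exp (- (real n * (c * (1 + t))))"
    if t: "0 \<le> t" "\<delta> \<le> \<bar>t - x\<bar>" for n N t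
  proof (cases "x \<le> t")
    case True
    with bound[of \<rho>1 c1 t] t right show ?thesis
      by (simp add: C_def c_def)
  next
    case False
    with bound[of \<rho>2 c2 t] t left show ?thesis
      by (simp add: C_def c_def)
  qed
  moreover have "0 < C" "0 < c"
    using right left by (auto simp: C_def c_def less_max_iff_disj)
  ultimately show ?thesis
    by blast
qed

section \<open>The operator at a point off the support\<close>

lemma integral_exp_minus_halfline:
  "set_integrable lebesgue {0..} (\<lambda>t. exp (- t :: real))"
  "(LINT t:{0..}|lebesgue. exp (- t :: real)) = 1"
proof -
  have hi: "((\<lambda>t::real. exp (- t)) has_integral 1) {0..}"
    using has_integral_exp_minus_to_infinity[of 1 0] by simp
  then show int: "set_integrable lebesgue {0..} (\<lambda>t. exp (- t :: real))"
    by (intro nonnegative_absolutely_integrable_1) auto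
  show "(LINT t:{0..}|lebesgue. exp (- t :: real)) = 1"
    using set_lebesgue_integral_eq_integral(2)[OF int] integral_unique[OF hi] by simp
qed

text \<open>
  The integral of a function that is not integrable is \<open>0\<close> by convention, so domination by an
  integrable function gives the inequality in every case.
\<close>

lemma abs_set_integral_le:
  fixes f g :: "real \<Rightarrow> real"
  assumes "set_integrable M S g" "\<And>t. t \<in> S \<Longrightarrow> \<bar>f t\<bar> \<le> g t"
  shows "\<bar>LINT t:S|M. f t\<bar> \<le> (LINT t:S|M. g t)"
proof (cases "set_integrable M S f")
  case True
  have "\<bar>LINT t:S|M. f t\<bar> \<le> (LINT t:S|M. \<bar>f t\<bar>)"
    using set_integral_norm_bound[OF True] by simp
  also have "\<dots> \<le> (LINT t:S|M. g t)"
    using assms True by (intro set_integral_mono set_integrable_abs) auto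
  finally show ?thesis .
next
  case False
  then have "(LINT t:S|M. f t) = 0"
    unfolding set_integrable_def set_lebesgue_integral_def by (rule not_integrable_integral_eq)
  moreover have "0 \<le> (LINT t:S|M. g t)"
    unfolding set_lebesgue_integral_def
    using assms(2) by (intro integral_nonneg_AE) (force simp: indicator_def)
  ultimately show ?thesis
    by simp
qed

lemma abs_suminf_le_const:
  fixes u :: "nat \<Rightarrow> real"
  assumes "\<And>N. (\<Sum>i<N. \<bar>u i\<bar>) \<le> B"
  shows "\<bar>suminf u\<bar> \<le> B"
proof -
  have s: "summable (\<lambda>i. \<bar>u i\<bar>)"
    using assms by (intro summableI_nonneg_bounded[of _ B]) auto
  have "\<bar>suminf u\<bar> \<le> (\<Sum>i. \<bar>u i\<bar>)"
    using summable_rabs[OF s] .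
  also have "\<dots> \<le> B"
    using s assms by (intro suminf_le_const) auto
  finally show ?thesis .
qed

text \<open>
  The weights are tilted down to the mean \<open>n * x / 2\<close>, after which each is at most \<open>1\<close>. The
  factors \<open>2 powi k\<close> are harmless because the range of \<open>k\<close> does not depend on \<open>n\<close>.
\<close>

lemma initial_sum_exponentially_small:
  assumes "0 \<le> x"
  shows "\<exists>M\<ge>0. \<forall>n. \<bar>\<Sum>k = 0..j - 1. s_basis n k x\<bar> \<le> M * exp (- (x / 2) * real n)"
proof (intro exI conjI allI)
  let ?M = "\<Sum>k = 0..j - 1. (2::real) powi k"
  show "0 \<le> ?M"
    by (intro sum_nonneg) auto
  fix n
  have "s_basis n k x \<le> 2 powi k * exp (- (x / 2) * real n)" for k
  proof -
    have "s_basis n k x = 2 powi k * exp (- (x / 2) * real n) * s_basis n k (x / 2)"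
      using s_basis_tilt[of "1/2" n k x]
      by (simp add: power_int_minus power_int_divide_distrib field_simps)
    also have "\<dots> \<le> 2 powi k * exp (- (x / 2) * real n) * 1"
      using assms by (intro mult_left_mono s_basis_le_1) auto
    finally show ?thesis by simp
  qed
  then have "(\<Sum>k = 0..j - 1. s_basis n k x) \<le> ?M * exp (- (x / 2) * real n)"
    unfolding sum_distrib_right by (intro sum_mono)
  moreover have "0 \<le> (\<Sum>k = 0..j - 1. s_basis n k x)"
    using assms by (intro sum_nonneg s_basis_nonneg)
  ultimately show "\<bar>\<Sum>k = 0..j - 1. s_basis n k x\<bar> \<le> ?M * exp (- (x / 2) * real n)"
    by simp
qed

text \<open>
  The kernel estimate is integrated against the bound on \<open>f\<close>. The assumption on \<open>n\<close> says that
  the decay \<open>exp (- c * n * t)\<close> of the kernel beats the growth \<open>exp (A * t)\<close> by a factor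
  \<open>exp (- t)\<close>, whose integral is \<open>1\<close>.
\<close>

lemma series_part_bound:
  fixes f :: "real \<Rightarrow> real"
  assumes x: "0 \<le> x"
    and K: "0 \<le> K" "\<And>t. 0 \<le> t \<Longrightarrow> \<bar>f t\<bar> \<le> K * exp (A * t)"
    and vanish: "\<And>t. 0 \<le> t \<Longrightarrow> \<bar>t - x\<bar> < \<delta> \<Longrightarrow> f t = 0"
    and C: "0 \<le> C"
    and kernel: "\<And>N t. 0 \<le> t \<Longrightarrow> \<delta> \<le> \<bar>t - x\<bar> \<Longrightarrow>
       (\<Sum>i<N. s_basis n (j + int i) x * s_basis n (int i) t) \<le> C * exp (- (real n * (c * (1 + t))))"
    and n: "A + 1 \<le> c * real n"
  shows "\<bar>\<Sum>i. s_basis n (j + int i) x * (real n * (LINT t:{0..}|lebesgue. s_basis n (int i) t * f t))\<bar>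
           \<le> real n * (C * K * exp (- (c * real n)))"
proof (rule abs_suminf_le_const)
  fix N
  \<comment> \<open>A measurable majorant of \<open>\<bar>f\<bar>\<close> that vanishes near \<open>x\<close>, where the kernel is not small.\<close>
  define h where "h t = (if \<bar>t - x\<bar> < \<delta> then 0 else K * exp (A * t))" for t
  define p where "p i t = s_basis n (j + int i) x * s_basis n (int i) t * h t" for i t
  define G where "G = C * K * exp (- (c * real n))"
  have h: "0 \<le> h t" for t
    using K by (simp add: h_def)
  have p_nonneg: "0 \<le> p i t" if "0 \<le> t" for i t
    unfolding p_def using x that h by (intro mult_nonneg_nonneg s_basis_nonneg)
  have sum_le: "(\<Sum>i<m. p i t) \<le> G * exp (- t)" if t: "0 \<le> t" for m t
  proof (cases "\<bar>t - x\<bar> < \<delta>")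
    case True
    then show ?thesis
      using C K by (simp add: p_def h_def G_def)
  next
    case False
    have "(A + 1) * t \<le> c * real n * t"
      using n t by (rule mult_right_mono)
    then have e: "- (real n * (c * (1 + t))) + A * t \<le> - (c * real n) - t"
      by (simp add: algebra_simps)
    have "(\<Sum>i<m. p i t) = (\<Sum>i<m. s_basis n (j + int i) x * s_basis n (int i) t) * h t"
      by (simp add: p_def sum_distrib_right)
    also have "\<dots> \<le> C * exp (- (real n * (c * (1 + t)))) * h t"
      using kernel[OF t] False h by (intro mult_right_mono) auto
    also have "\<dots> = C * K * exp (- (real n * (c * (1 + t))) + A * t)"
      unfolding exp_add using False by (simp add: h_def)
    also have "\<dots> \<le> C * K * exp (- (c * real n) - t)"
      using e C K by (intro mult_left_mono) auto
    also have "\<dots> = G * exp (- t)"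
      by (simp add: G_def exp_diff exp_minus field_simps)
    finally show ?thesis .
  qed
  have G_int: "set_integrable lebesgue {0..} (\<lambda>t. G * exp (- t))"
    by (intro set_integrable_mult_right integral_exp_minus_halfline)
  have p_meas: "p i \<in> borel_measurable borel" for i
    unfolding p_def h_def s_basis_def by measurable
  have p_int: "set_integrable lebesgue {0..} (p i)" for i
  proof (rule set_integrable_bound[OF G_int])
    show "set_borel_measurable lebesgue {0..} (p i)"
      unfolding set_borel_measurable_def
      using p_meas[of i] by (intro measurable_completion) (simp add: borel_measurable_indicator)
    have "\<bar>p i t\<bar> \<le> \<bar>G * exp (- t)\<bar>" if "0 \<le> t" for t
    proof -
      have "p i t \<le> (\<Sum>m<Suc i. p m t)"
        using p_nonneg[OF that] by (intro member_le_sum) auto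
      also have "\<dots> \<le> G * exp (- t)"
        using sum_le[OF that] .
      finally show ?thesis
        using p_nonneg[OF that, of i] by simp
    qed
    then show "AE t in lebesgue. t \<in> {0..} \<longrightarrow> norm (p i t) \<le> norm (G * exp (- t))"
      by simp
  qed
  have term_le: "\<bar>s_basis n (j + int i) x * (real n * (LINT t:{0..}|lebesgue. s_basis n (int i) t * f t))\<bar>
      \<le> real n * (LINT t:{0..}|lebesgue. p i t)" for i
  proof -
    have "\<bar>s_basis n (j + int i) x * (s_basis n (int i) t * f t)\<bar> \<le> p i t" if "t \<in> {0..}" for t
    proof -
      have "\<bar>f t\<bar> \<le> h t"
        using that K vanish by (simp add: h_def)
      then show ?thesis
        using that x s_basis_nonneg
        by (auto simp: p_def abs_mult mult.assoc intro!: mult_left_mono)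
    qed
    from abs_set_integral_le[OF p_int this]
    have "\<bar>s_basis n (j + int i) x * (LINT t:{0..}|lebesgue. s_basis n (int i) t * f t)\<bar>
        \<le> (LINT t:{0..}|lebesgue. p i t)"
      by simp
    from mult_left_mono[OF this, of "real n"] show ?thesis
      by (simp add: abs_mult mult.left_commute)
  qed
  have "(\<Sum>i<N. \<bar>s_basis n (j + int i) x * (real n * (LINT t:{0..}|lebesgue. s_basis n (int i) t * f t))\<bar>)
      \<le> real n * (\<Sum>i<N. LINT t:{0..}|lebesgue. p i t)"
    unfolding sum_distrib_left by (intro sum_mono term_le)
  also have "(\<Sum>i<N. LINT t:{0..}|lebesgue. p i t) = (LINT t:{0..}|lebesgue. (\<Sum>i<N. p i t))"
    using p_int unfolding set_integrable_def set_lebesgue_integral_def scaleR_sum_right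
    by (intro Bochner_Integration.integral_sum[symmetric]) auto
  also have "\<dots> \<le> (LINT t:{0..}|lebesgue. G * exp (- t))"
  proof (rule set_integral_mono[OF _ G_int])
    show "set_integrable lebesgue {0..} (\<lambda>t. \<Sum>i<N. p i t)"
      using p_int unfolding set_integrable_def scaleR_sum_right
      by (intro Bochner_Integration.integrable_sum) auto
  qed (use sum_le in auto)
  also have "\<dots> = G"
    by (simp add: integral_exp_minus_halfline)
  finally show "(\<Sum>i<N. \<bar>s_basis n (j + int i) x * (real n * (LINT t:{0..}|lebesgue. s_basis n (int i) t * f t))\<bar>)
      \<le> real n * (C * K * exp (- (c * real n)))"
    unfolding G_def by (simp add: mult_left_mono)
qed

theorem theorem17:
  fixes j :: int and f :: "real \<Rightarrow> real" and x \<delta> :: real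
  assumes "f \<in> E_union"
    and "x \<ge> 0"
    and "\<delta> > 0"
    and "\<forall>t \<in> {x - \<delta><..<x + \<delta>} \<inter> {0..}. f t = 0"
  shows "\<exists>c>0. (\<lambda>n. S_op n j f x) \<in> O(\<lambda>n. exp (- c * real n))"
proof -
  have vanish: "f t = 0" if "0 \<le> t" "\<bar>t - x\<bar> < \<delta>" for t
    using assms(4) that by (auto simp: abs_less_iff)
  obtain A K where K: "0 < K" "\<And>t. 0 \<le> t \<Longrightarrow> \<bar>f t\<bar> \<le> K * exp (A * t)"
    using assms(1) by (auto simp: E_union_def E_space_def)
  obtain C c where C: "0 < C" and c: "0 < c"
    and kernel: "\<And>n N t. 0 \<le> t \<Longrightarrow> \<delta> \<le> \<bar>t - x\<bar> \<Longrightarrow>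
       (\<Sum>i<N. s_basis n (j + int i) x * s_basis n (int i) t) \<le> C * exp (- (real n * (c * (1 + t))))"
    using kernel_localization[OF assms(2,3), of j] by blast
  obtain M where M: "0 \<le> M"
      "\<And>n. \<bar>\<Sum>k = 0..j - 1. s_basis n k x\<bar> \<le> M * exp (- (x / 2) * real n)"
    using initial_sum_exponentially_small[OF assms(2)] by blast
  \<comment> \<open>Half of \<open>c\<close> is given up to absorb the factor \<open>n\<close> in front of the integrals.\<close>
  define d where "d = (if x < \<delta> then c / 2 else min (c / 2) (x / 2))"
  have d: "0 < d" "d \<le> c / 2"
    using c assms(3) by (auto simp: d_def)
  have first: "\<bar>f 0 * (\<Sum>k = 0..j - 1. s_basis n k x)\<bar> \<le> \<bar>f 0\<bar> * M * exp (- d * real n)" for n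
  proof (cases "x < \<delta>")
    case True
    then show ?thesis
      using vanish[of 0] assms(2) by simp
  next
    case False
    then have "d * real n \<le> x / 2 * real n"
      by (intro mult_right_mono) (auto simp: d_def)
    then have "M * exp (- (x / 2) * real n) \<le> M * exp (- d * real n)"
      using M(1) by (intro mult_left_mono) auto
    with M(2)[of n] show ?thesis
      unfolding abs_mult mult.assoc by (intro mult_left_mono) auto
  qed
  have second: "\<bar>\<Sum>i. s_basis n (j + int i) x * (real n * (LINT t:{0..}|lebesgue. s_basis n (int i) t * f t))\<bar>
      \<le> C * K * (2 / c) * exp (- d * real n)" if n: "A + 1 \<le> c * real n" for n
  proof -
    have "c / 2 * real n \<le> exp (c / 2 * real n)"
      using exp_ge_add_one_self[of "c / 2 * real n"] by linarith
    then have "real n \<le> 2 / c * exp (c / 2 * real n)"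
      using c by (simp add: field_simps)
    then have "real n * exp (- (c * real n)) \<le> 2 / c * exp (c / 2 * real n) * exp (- (c * real n))"
      by (intro mult_right_mono) auto
    also have "\<dots> = 2 / c * exp (- (c / 2 * real n))"
      by (simp add: mult.assoc exp_add[symmetric])
    also have "\<dots> \<le> 2 / c * exp (- d * real n)"
      using c mult_right_mono[OF d(2), of "real n"] by (intro mult_left_mono) auto
    finally have "C * K * (real n * exp (- (c * real n))) \<le> C * K * (2 / c * exp (- d * real n))"
      using C K by (intro mult_left_mono) auto
    moreover have "\<bar>\<Sum>i. s_basis n (j + int i) x * (real n * (LINT t:{0..}|lebesgue. s_basis n (int i) t * f t))\<bar>
        \<le> real n * (C * K * exp (- (c * real n)))"
      using K C by (intro series_part_bound[OF assms(2) _ _ vanish _ kernel n]) auto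
    ultimately show ?thesis
      by (simp add: mult_ac)
  qed
  have "eventually (\<lambda>n. A + 1 \<le> c * real n) sequentially"
    using eventually_ge_at_top[of "nat \<lceil>(A + 1) / c\<rceil>"]
  proof eventually_elim
    case (elim n)
    then have "(A + 1) / c \<le> real n"
      by linarith
    then show ?case
      using c by (simp add: field_simps)
  qed
  then have "eventually (\<lambda>n. norm (S_op n j f x) \<le>
      (\<bar>f 0\<bar> * M + C * K * (2 / c)) * norm (exp (- d * real n))) sequentially"
  proof eventually_elim
    case (elim n)
    show ?case
      using add_mono[OF first[of n] second[OF elim]]
      by (auto simp: S_op_def Let_def distrib_right intro: order_trans[OF abs_triangle_ineq])
  qed
  then have "(\<lambda>n. S_op n j f x) \<in> O(\<lambda>n. exp (- d * real n))"
    by (rule bigoI)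
  with d show ?thesis
    by blast
qed

end
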